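(* Let $\kappa\ge\omega_1$ be a cardinal. If there are cardinals $\mu$ and $\theta$ such that $\mu^{<\theta}=\mu<\kappa\le\mu^\theta$, then $\kappa$ is not $\kappa$-square compact.
   Context: A topological space $X$ is $\kappa$-compact if every open cover of $X$ has a subcover of size less than $\kappa$. The weight of a space is the least cardinality of a base for its topology. An infinite cardinal $\kappa$ is $\kappa$-square compact if for every topological space $X$ of weight $\le\kappa$, if $X$ is $\kappa$-compact then $X^2$ (with the product topology) is $\kappa$-compact. *)

theory Defs
  imports "HOL-Analysis.Analysis"
begin

unbundle cardinal_syntax
no_notation elt_set_eq (infix \<open>=o\<close> 50)

text \<open>Cardinals are relations \<open>r\<close> with \<open>Card_order r\<close>, compared by \<open>\<le>o\<close>, \<open><o\<close> and \<open>=o\<close>.\<close>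

definition topology_base :: "'a topology \<Rightarrow> 'a set set \<Rightarrow> bool" where
  "topology_base X \<B> \<longleftrightarrow> (\<forall>V\<in>\<B>. openin X V) \<and>
     (\<forall>U x. openin X U \<and> x \<in> U \<longrightarrow> (\<exists>V\<in>\<B>. x \<in> V \<and> V \<subseteq> U))"

definition weight :: "'a topology \<Rightarrow> 'a set rel" where
  "weight X = |SOME \<B>. topology_base X \<B> \<and> (\<forall>\<B>'. topology_base X \<B>' \<longrightarrow> |\<B>| \<le>o |\<B>'| )|"

definition kappa_compact :: "'k rel \<Rightarrow> 'a topology \<Rightarrow> bool" where
  "kappa_compact \<kappa> X \<longleftrightarrow>
     (\<forall>\<U>. (\<forall>U\<in>\<U>. openin X U) \<and> \<Union>\<U> = topspace X \<longrightarrow>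
        (\<exists>\<V>\<subseteq>\<U>. |\<V>| <o \<kappa> \<and> \<Union>\<V> = topspace X))"

text \<open>The points of \<open>X\<close> are taken from the power set type \<open>'k set\<close>. Nothing is lost: the
  Kolmogorov quotient of a space of weight at most \<open>\<kappa>\<close> has at most \<open>2\<^sup>\<kappa>\<close> points, and
  \<open>square_compact_any_type\<close> below derives the property for spaces over an arbitrary type.\<close>

definition square_compact :: "'k rel \<Rightarrow> bool" where
  "square_compact \<kappa> \<longleftrightarrow>
     (\<forall>X :: 'k set topology. weight X \<le>o \<kappa> \<and> kappa_compact \<kappa> X \<longrightarrow>
        kappa_compact \<kappa> (prod_topology X X))"

text \<open>\<open>cexp_less \<mu> \<theta>\<close> is \<open>\<mu>\<close> to the power \<open><\<theta>\<close>, the supremum of the cardinals \<open>\<mu> ^c \<nu>\<close> over all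
  cardinals \<open>\<nu> <o \<theta>\<close>. Every such \<open>\<nu>\<close> is represented on the type of \<open>\<theta>\<close>, and
  the supremum on the type of the powers; the choice is unique up to \<open>=o\<close>.\<close>

definition cexp_less_bound :: "'m rel \<Rightarrow> 't rel \<Rightarrow> 's rel \<Rightarrow> bool" where
  "cexp_less_bound \<mu> \<theta> r \<longleftrightarrow>
     Card_order r \<and> (\<forall>\<nu> :: 't rel. Card_order \<nu> \<and> \<nu> <o \<theta> \<longrightarrow> \<mu> ^c \<nu> \<le>o r)"

definition cexp_less :: "'m rel \<Rightarrow> 't rel \<Rightarrow> ('t \<Rightarrow> 'm) rel" where
  "cexp_less \<mu> \<theta> =
     (SOME r. cexp_less_bound \<mu> \<theta> r \<and>
        (\<forall>r' :: ('t \<Rightarrow> 'm) rel. cexp_less_bound \<mu> \<theta> r' \<longrightarrow> r \<le>o r'))"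

lemma weight_attained:
  obtains \<B> where "topology_base X \<B>" "weight X = |\<B>|"
    "\<And>\<B>'. topology_base X \<B>' \<Longrightarrow> |\<B>| \<le>o |\<B>'|"
proof -
  have "topology_base X {U. openin X U}"
    by (auto simp: topology_base_def)
  then have "\<exists>r\<in>{|\<B>| |\<B>. topology_base X \<B>}. \<forall>r'\<in>{|\<B>| |\<B>. topology_base X \<B>}. r \<le>o r'"
    by (intro exists_minim_Card_order) (auto simp: card_of_Card_order)
  then have "\<exists>\<B>. topology_base X \<B> \<and> (\<forall>\<B>'. topology_base X \<B>' \<longrightarrow> |\<B>| \<le>o |\<B>'| )"
    by blast
  from someI_ex[OF this] that show thesis
    unfolding weight_def by blast
qed

lemma weight_ordLeq_iff:
  "weight X \<le>o r \<longleftrightarrow> (\<exists>\<B>. topology_base X \<B> \<and> |\<B>| \<le>o r)"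
proof (rule weight_attained[of X])
  fix \<B> assume \<B>: "topology_base X \<B>" "weight X = |\<B>|"
    "\<And>\<B>'. topology_base X \<B>' \<Longrightarrow> |\<B>| \<le>o |\<B>'|"
  then show ?thesis
    using ordLeq_transitive[OF \<B>(3)] by auto
qed

lemma cexp_less_is_least_bound:
  fixes \<mu> :: "'m rel" and \<theta> :: "'t rel" and s :: "'s rel"
  shows "cexp_less_bound \<mu> \<theta> (cexp_less \<mu> \<theta>)" (is ?A)
  "cexp_less_bound \<mu> \<theta> s \<Longrightarrow> cexp_less \<mu> \<theta> \<le>o s"
proof -
  let ?R = "{r. cexp_less_bound \<mu> \<theta> (r :: ('t \<Rightarrow> 'm) rel)}"
  have "cexp_less_bound \<mu> \<theta> |UNIV :: ('t \<Rightarrow> 'm) set|"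
    by (simp add: cexp_less_bound_def cexp_def card_of_Card_order card_of_mono1)
  then have "\<exists>r\<in>?R. \<forall>r'\<in>?R. r \<le>o r'"
    by (intro exists_minim_Card_order) (auto simp: cexp_less_bound_def)
  then have "\<exists>r :: ('t \<Rightarrow> 'm) rel. cexp_less_bound \<mu> \<theta> r \<and>
      (\<forall>r' :: ('t \<Rightarrow> 'm) rel. cexp_less_bound \<mu> \<theta> r' \<longrightarrow> r \<le>o r')"
    by blast
  from someI_ex[OF this]
  have A: ?A and least: "\<And>r' :: ('t \<Rightarrow> 'm) rel. cexp_less_bound \<mu> \<theta> r' \<Longrightarrow> cexp_less \<mu> \<theta> \<le>o r'"
    unfolding cexp_less_def by blast+
  show ?A by (rule A)
  assume s: "cexp_less_bound \<mu> \<theta> s"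
  show "cexp_less \<mu> \<theta> \<le>o s"
  proof (rule ccontr)
    assume "\<not> cexp_less \<mu> \<theta> \<le>o s"
    moreover have "Well_order s" "Well_order (cexp_less \<mu> \<theta>)"
      using s A by (auto simp: cexp_less_bound_def card_order_on_well_order_on)
    ultimately have less: "s <o cexp_less \<mu> \<theta>"
      using not_ordLeq_iff_ordLess by blast
    have "|Field s| =o s"
      using s by (simp add: cexp_less_bound_def card_of_Field_ordIso)
    moreover from this have "|Field s| \<le>o cexp_less \<mu> \<theta>"
      using less by (meson ordIso_ordLess_trans ordLess_imp_ordLeq)
    ultimately obtain B where B: "B \<subseteq> Field (cexp_less \<mu> \<theta>)" "s =o |B|"
      by (metis internalize_card_of_ordLeq ordIso_symmetric ordIso_transitive)
    have "cexp_less_bound \<mu> \<theta> |B|"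
      using s B(2) unfolding cexp_less_bound_def by (meson card_of_Card_order ordLeq_ordIso_trans)
    then have "cexp_less \<mu> \<theta> \<le>o s"
      using ordLeq_ordIso_trans[OF least ordIso_symmetric[OF B(2)]] by blast
    then show False
      using less not_ordLess_ordLeq by blast
  qed
qed

lemma square_compact_any_type:
  fixes X :: "'a topology" and \<kappa> :: "'k rel"
  assumes sq: "square_compact \<kappa>" and w: "weight X \<le>o \<kappa>" and X: "kappa_compact \<kappa> X"
  shows "kappa_compact \<kappa> (prod_topology X X)"
proof -
  obtain \<B> where \<B>: "topology_base X \<B>" "|\<B>| \<le>o \<kappa>"
    using w by (auto simp: weight_ordLeq_iff)
  obtain C where C: "C \<subseteq> Field \<kappa>" "|\<B>| =o |C|"
    using iffD1[OF internalize_card_of_ordLeq \<B>(2)] by auto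
  obtain e where "bij_betw e \<B> C"
    using iffD2[OF card_of_ordIso C(2)] by auto
  then have e: "inj_on e \<B>"
    by (rule bij_betw_imp_inj_on)
  define f where "f x = e ` {b\<in>\<B>. x \<in> b}" for x
  have f_eq: "b \<in> \<B> \<Longrightarrow> f x = f y \<Longrightarrow> x \<in> b \<Longrightarrow> y \<in> b" for x y b
    using e unfolding f_def inj_on_def by blast
  have sat: "y \<in> U" if "openin X U" "x \<in> U" "f x = f y" for U x y
    using that \<B>(1) f_eq unfolding topology_base_def by (meson subsetD)
  have Int: "f ` U \<inter> f ` V = f ` (U \<inter> V)" if "openin X U" "openin X V" for U V
    using sat that by (fastforce simp: image_iff)
  define P where "P W \<longleftrightarrow> (\<exists>U. openin X U \<and> W = f ` U)" for W
  have "istopology P"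
    unfolding istopology_def
  proof (intro conjI allI impI)
    fix S T assume "P S" "P T"
    then show "P (S \<inter> T)"
      unfolding P_def using Int by (metis openin_Int)
  next
    fix \<K> assume "\<forall>K\<in>\<K>. P K"
    then obtain g where g: "\<And>K. K \<in> \<K> \<Longrightarrow> openin X (g K) \<and> K = f ` g K"
      unfolding P_def by metis
    then have "\<Union>\<K> = f ` \<Union>(g ` \<K>)" by blast
    moreover have "openin X (\<Union>(g ` \<K>))" using g by blast
    ultimately show "P (\<Union>\<K>)" unfolding P_def by blast
  qed
  then have Y: "openin (topology P) = P" by (rule topology_inverse')
  let ?Y = "topology P"
  have top: "topspace ?Y = f ` topspace X"
  proof
    have "P (topspace ?Y)"
      using openin_topspace[of ?Y] by (simp only: Y)
    then obtain U where "openin X U" "topspace ?Y = f ` U"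
      unfolding P_def by auto
    then show "topspace ?Y \<subseteq> f ` topspace X"
      using openin_subset[of X U] by auto
    have "P (f ` topspace X)"
      unfolding P_def by auto
    then show "f ` topspace X \<subseteq> topspace ?Y"
      by (intro openin_subset) (simp only: Y)
  qed
  have "topology_base ?Y ((`) f ` \<B>)"
    unfolding topology_base_def Y
  proof (intro conjI ballI allI impI)
    fix V assume "V \<in> (`) f ` \<B>"
    then show "P V" using \<B>(1) unfolding P_def topology_base_def by blast
  next
    fix W y assume "P W \<and> y \<in> W"
    then obtain U x where U: "openin X U" "W = f ` U" "x \<in> U" "y = f x"
      unfolding P_def by blast
    then obtain V where "V \<in> \<B>" "x \<in> V" "V \<subseteq> U"
      using \<B>(1) unfolding topology_base_def by meson
    then show "\<exists>V\<in>(`) f ` \<B>. y \<in> V \<and> V \<subseteq> W" using U by blast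
  qed
  then have wY: "weight ?Y \<le>o \<kappa>"
    using ordLeq_transitive[OF card_of_image \<B>(2)] unfolding weight_ordLeq_iff by blast
  have "kappa_compact \<kappa> ?Y"
    unfolding kappa_compact_def
  proof (intro allI impI)
    fix \<U> assume \<U>: "(\<forall>U\<in>\<U>. openin ?Y U) \<and> \<Union>\<U> = topspace ?Y"
    then obtain g where g: "\<And>K. K \<in> \<U> \<Longrightarrow> openin X (g K) \<and> K = f ` g K"
      unfolding Y P_def by metis
    have "\<Union>(g ` \<U>) = topspace X"
    proof
      show "\<Union>(g ` \<U>) \<subseteq> topspace X" using g openin_subset by blast
      show "topspace X \<subseteq> \<Union>(g ` \<U>)"
      proof
        fix x assume "x \<in> topspace X"
        then have "f x \<in> topspace ?Y" unfolding top by (rule imageI)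
        then have "f x \<in> \<Union>\<U>" using conjunct2[OF \<U>] by simp
        then obtain K where K: "K \<in> \<U>" "f x \<in> K" by (rule UnionE)
        have gK: "openin X (g K)" "K = f ` g K" using g[OF K(1)] by simp_all
        have "f x \<in> f ` g K" using K(2) gK(2) by simp
        then obtain z where "z \<in> g K" "f z = f x" by (metis imageE)
        then have "x \<in> g K" using sat[OF gK(1)] by metis
        then show "x \<in> \<Union>(g ` \<U>)" using K(1) by (rule UN_I[rotated])
      qed
    qed
    moreover have "\<forall>U\<in>g ` \<U>. openin X U"
      using g by simp
    ultimately obtain \<V> where \<V>: "\<V> \<subseteq> g ` \<U>" "|\<V>| <o \<kappa>" "\<Union>\<V> = topspace X"
      using X unfolding kappa_compact_def by meson
    have "(`) f ` \<V> \<subseteq> \<U>"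
    proof (rule image_subsetI)
      fix V assume "V \<in> \<V>"
      with \<V>(1) obtain K where "K \<in> \<U>" "V = g K" by auto
      with g[of K] show "f ` V \<in> \<U>" by simp
    qed
    moreover have "|(`) f ` \<V>| <o \<kappa>"
      by (rule ordLeq_ordLess_trans[OF card_of_image \<V>(2)])
    moreover have "\<Union>((`) f ` \<V>) = topspace ?Y"
      unfolding top \<V>(3)[symmetric] by auto
    ultimately show "\<exists>\<V>\<subseteq>\<U>. |\<V>| <o \<kappa> \<and> \<Union>\<V> = topspace ?Y" by blast
  qed
  then have YY: "kappa_compact \<kappa> (prod_topology ?Y ?Y)"
    using sq wY unfolding square_compact_def by blast
  let ?h = "map_prod f f"
  have sat2: "q \<in> U" if U: "openin (prod_topology X X) U" "p \<in> U" "?h p = ?h q" for U p q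
  proof -
    obtain a b c d where pq: "p = (a, b)" "q = (c, d)" by (metis surj_pair)
    then obtain V W where "openin X V" "openin X W" "a \<in> V" "b \<in> W" "V \<times> W \<subseteq> U"
      using U by (metis openin_prod_topology_alt)
    then show ?thesis using sat U(3) pq by auto
  qed
  have open2: "openin (prod_topology ?Y ?Y) (?h ` U)" if U: "openin (prod_topology X X) U" for U
    unfolding openin_prod_topology_alt
  proof (intro allI impI)
    fix x y assume "(x, y) \<in> ?h ` U"
    then obtain a b where ab: "(a, b) \<in> U" "x = f a" "y = f b" by auto
    then obtain V W where VW: "openin X V" "openin X W" "a \<in> V" "b \<in> W" "V \<times> W \<subseteq> U"
      using U by (metis openin_prod_topology_alt)
    then have "f ` V \<times> f ` W \<subseteq> ?h ` U" by auto
    then show "\<exists>U' V'. openin ?Y U' \<and> openin ?Y V' \<and> x \<in> U' \<and> y \<in> V' \<and> U' \<times> V' \<subseteq> ?h ` U"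
      unfolding Y P_def using VW ab by blast
  qed
  show ?thesis
    unfolding kappa_compact_def
  proof (intro allI impI)
    fix \<U> assume \<U>: "(\<forall>U\<in>\<U>. openin (prod_topology X X) U) \<and> \<Union>\<U> = topspace (prod_topology X X)"
    have "\<Union>((`) ?h ` \<U>) = ?h ` \<Union>\<U>" by blast
    also have "\<dots> = topspace (prod_topology ?Y ?Y)"
      using \<U> top by (simp add: map_prod_surj_on)
    finally have "\<Union>((`) ?h ` \<U>) = topspace (prod_topology ?Y ?Y)" .
    moreover have "\<forall>V\<in>(`) ?h ` \<U>. openin (prod_topology ?Y ?Y) V"
      using \<U> open2 by blast
    ultimately obtain \<V> where \<V>: "\<V> \<subseteq> (`) ?h ` \<U>" "|\<V>| <o \<kappa>"
        "\<Union>\<V> = topspace (prod_topology ?Y ?Y)"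
      using YY unfolding kappa_compact_def by meson
    have "\<forall>V\<in>\<V>. \<exists>U. U \<in> \<U> \<and> V = ?h ` U"
      using \<V>(1) by auto
    from bchoice[OF this] obtain g where g: "\<And>V. V \<in> \<V> \<Longrightarrow> g V \<in> \<U> \<and> V = ?h ` g V"
      by auto
    have "g ` \<V> \<subseteq> \<U>" using g by (intro image_subsetI) simp
    moreover have "|g ` \<V>| <o \<kappa>"
      by (rule ordLeq_ordLess_trans[OF card_of_image \<V>(2)])
    moreover have "\<Union>(g ` \<V>) = topspace (prod_topology X X)"
    proof
      show "\<Union>(g ` \<V>) \<subseteq> topspace (prod_topology X X)"
        unfolding conjunct2[OF \<U>, symmetric]
        by (rule Union_mono) (use g in \<open>intro image_subsetI, simp\<close>)
      show "topspace (prod_topology X X) \<subseteq> \<Union>(g ` \<V>)"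
      proof
        fix q assume "q \<in> topspace (prod_topology X X)"
        then have "?h q \<in> \<Union>\<V>" unfolding \<V>(3) by (auto simp: top)
        then obtain V where V: "V \<in> \<V>" "?h q \<in> V" by (rule UnionE)
        have gV: "g V \<in> \<U>" "V = ?h ` g V" using g[OF V(1)] by simp_all
        have "?h q \<in> ?h ` g V" using V(2) gV(2) by simp
        then obtain p where p: "p \<in> g V" "?h p = ?h q" by (metis imageE)
        have "openin (prod_topology X X) (g V)" using \<U> gV(1) by simp
        then have "q \<in> g V" using sat2 p by metis
        then show "q \<in> \<Union>(g ` \<V>)" using V(1) by (rule UN_I[rotated])
      qed
    qed
    ultimately show "\<exists>\<V>\<subseteq>\<U>. |\<V>| <o \<kappa> \<and> \<Union>\<V> = topspace (prod_topology X X)" by blast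
  qed
qed

end

theory Submission
  imports Defs
begin

text \<open>Idea: order \<open>\<mu>\<^sup>\<theta>\<close> lexicographically, and let \<open>X\<close> be a subset of size \<open>\<kappa>\<close>. There are only
  \<open>\<mu>\<^sup>{<\<theta>} = \<mu>\<close> many cones (sets of functions with a prescribed initial segment), and they play the
  role of the rational intervals: the argument for the Sorgenfrey line shows that every open cover
  of \<open>X\<close> in the topology generated by the right halves of cones has a subcover of size at most
  \<open>\<mu>\<close>, and likewise for left halves. The disjoint sum of these two Sorgenfrey topologies
  is thus \<open>\<kappa>\<close>-compact, but its square contains the diagonal of \<open>X\<close>, taken between the two
  summands, as a closed discrete set of size \<open>\<kappa>\<close>.\<close>

section \<open>The covering argument of the Sorgenfrey line\<close>

text \<open>By \<open>refine\<close>, an open half of a member of \<T> at one of its points is a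
  union of members of \<T>, so the points inside such halves are handled by choosing one index per
  member of \<T>. The remaining points inject into \<T> and get one index each.\<close>

lemma sorgenfrey_subcover:
  fixes lt :: "'a \<Rightarrow> 'a \<Rightarrow> bool" and \<mu> :: "'m rel" and U :: "'i \<Rightarrow> 'a set"
  assumes total: "\<And>x y. x \<in> X \<Longrightarrow> y \<in> X \<Longrightarrow> x \<noteq> y \<Longrightarrow> lt x y \<or> lt y x"
    and refine: "\<And>T x y. T \<in> \<T> \<Longrightarrow> x \<in> T \<Longrightarrow> y \<in> T \<Longrightarrow> lt x y \<Longrightarrow>
      \<exists>T'\<in>\<T>. y \<in> T' \<and> T' \<subseteq> {z \<in> T. lt x z}"
    and card: "|\<T>| \<le>o \<mu>" "Cinfinite \<mu>"
    and nbhd: "\<And>x. x \<in> X \<Longrightarrow> \<exists>i\<in>I. \<exists>T\<in>\<T>. x \<in> T \<and> (\<forall>z\<in>T. z = x \<or> lt x z \<longrightarrow> z \<in> U i)"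
  shows "\<exists>J\<subseteq>I. |J| \<le>o \<mu> \<and> X \<subseteq> (\<Union>i\<in>J. U i)"
proof -
  obtain u t where ut: "\<And>x. x \<in> X \<Longrightarrow> u x \<in> I \<and> t x \<in> \<T> \<and> x \<in> t x \<and>
      (\<forall>z\<in>t x. z = x \<or> lt x z \<longrightarrow> z \<in> U (u x))"
    using nbhd by metis
  \<comment> \<open>\<open>R\<close> holds the exceptional points: those that lie in no open half of
    a chosen neighbourhood \<open>t x\<close>.\<close>
  define R where "R = {y \<in> X. \<forall>x\<in>X. y \<in> t x \<longrightarrow> \<not> lt x y}"
  \<comment> \<open>The members of \<T> that fit into a single open half; \<open>c\<close> below
    picks the centre of one such half for each of them.\<close>
  define \<T>' where "\<T>' = {T \<in> \<T>. \<exists>x\<in>X. T \<subseteq> {z \<in> t x. lt x z}}"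
  have "\<forall>T\<in>\<T>'. \<exists>x. x \<in> X \<and> T \<subseteq> {z \<in> t x. lt x z}"
    unfolding \<T>'_def by blast
  from bchoice[OF this] obtain c where
    c: "\<And>T. T \<in> \<T>' \<Longrightarrow> c T \<in> X \<and> T \<subseteq> {z \<in> t (c T). lt (c T) z}"
    by blast
  \<comment> \<open>If two points share the member \<open>t x = t y\<close>, it contains both, and
    one of them lies in the open half of the other, which \<open>R\<close> forbids.\<close>
  have "inj_on t R"
  proof (rule inj_onI, rule ccontr)
    fix x y assume xy: "x \<in> R" "y \<in> R" "t x = t y" "x \<noteq> y"
    then have "x \<in> X" "y \<in> X" by (auto simp: R_def)
    then have "x \<in> t y" "y \<in> t x" using ut xy(3) by auto
    then show False
      using xy total[OF \<open>x \<in> X\<close> \<open>y \<in> X\<close>] \<open>x \<in> X\<close> \<open>y \<in> X\<close> by (auto simp: R_def)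
  qed
  moreover have "t ` R \<subseteq> \<T>" using ut by (auto simp: R_def)
  ultimately have "|R| \<le>o |\<T>|" using card_of_ordLeq by blast
  then have "|R| \<le>o \<mu>" using card(1) ordLeq_transitive by blast
  moreover have "|\<T>'| \<le>o |\<T>|" by (rule card_of_mono1) (auto simp: \<T>'_def)
  then have "|c ` \<T>'| \<le>o \<mu>"
    by (intro ordLeq_transitive[OF card_of_image] ordLeq_transitive[OF _ card(1)])
  ultimately have "|R \<union> c ` \<T>'| \<le>o \<mu>"
    using card(2) by (intro card_of_Un_ordLeq_infinite_Field) (auto simp: cinfinite_def)
  then have "|u ` (R \<union> c ` \<T>')| \<le>o \<mu>"
    by (rule ordLeq_transitive[OF card_of_image])
  moreover have "u ` (R \<union> c ` \<T>') \<subseteq> I"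
    using ut c by (auto simp: R_def)
  moreover have "X \<subseteq> (\<Union>i\<in>u ` (R \<union> c ` \<T>'). U i)"
  proof
    fix y assume y: "y \<in> X"
    show "y \<in> (\<Union>i\<in>u ` (R \<union> c ` \<T>'). U i)"
    proof (cases "y \<in> R")
      case True
      then show ?thesis using ut[OF y] by blast
    next
      case False
      then obtain x where x: "x \<in> X" "y \<in> t x" "lt x y" using y by (auto simp: R_def)
      obtain T where T: "T \<in> \<T>" "y \<in> T" "T \<subseteq> {z \<in> t x. lt x z}"
        using refine[of "t x" x y] ut[OF x(1)] x by blast
      then have "T \<in> \<T>'" using x(1) by (auto simp: \<T>'_def)
      with c[OF this] T(2) ut[of "c T"] show ?thesis by blast
    qed
  qed
  ultimately show ?thesis by blast
qed

section \<open>The doubled Sorgenfrey space and its square\<close>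

text \<open>This collects what is used of the lexicographic order and its cones: \<T> is a base of a
  Hausdorff topology on \<open>X\<close> in which the open halves of each member are open.\<close>

locale double_sorgenfrey =
  fixes X :: "'a set" and lt :: "'a \<Rightarrow> 'a \<Rightarrow> bool" and \<T> :: "'a set set"
  assumes total: "\<And>x y. x \<in> X \<Longrightarrow> y \<in> X \<Longrightarrow> x \<noteq> y \<Longrightarrow> lt x y \<or> lt y x"
    and asym: "\<And>x y. x \<in> X \<Longrightarrow> y \<in> X \<Longrightarrow> lt x y \<Longrightarrow> \<not> lt y x"
    and subset: "\<And>T. T \<in> \<T> \<Longrightarrow> T \<subseteq> X"
    and covers: "X \<subseteq> \<Union>\<T>"
    and filtered: "\<And>S T x. S \<in> \<T> \<Longrightarrow> T \<in> \<T> \<Longrightarrow> x \<in> S \<Longrightarrow> x \<in> T \<Longrightarrow>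
      \<exists>T'\<in>\<T>. x \<in> T' \<and> T' \<subseteq> S \<inter> T"
    and separated: "\<And>x y. x \<in> X \<Longrightarrow> y \<in> X \<Longrightarrow> x \<noteq> y \<Longrightarrow>
      \<exists>S\<in>\<T>. \<exists>T\<in>\<T>. x \<in> S \<and> y \<in> T \<and> S \<inter> T = {}"
    and refine_right: "\<And>T x y. T \<in> \<T> \<Longrightarrow> x \<in> T \<Longrightarrow> y \<in> T \<Longrightarrow> lt x y \<Longrightarrow>
      \<exists>T'\<in>\<T>. y \<in> T' \<and> T' \<subseteq> {z \<in> T. lt x z}"
    and refine_left: "\<And>T x y. T \<in> \<T> \<Longrightarrow> x \<in> T \<Longrightarrow> y \<in> T \<Longrightarrow> lt y x \<Longrightarrow>
      \<exists>T'\<in>\<T>. y \<in> T' \<and> T' \<subseteq> {z \<in> T. lt z x}"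
begin

text \<open>Reversing the order under the tag \<open>False\<close> lets one argument serve both
  summands: \<open>True\<close> marks the copy with right halves, \<open>False\<close> the copy with
  left halves.\<close>

definition dlt :: "bool \<Rightarrow> 'a \<Rightarrow> 'a \<Rightarrow> bool" where
  "dlt b x y = (if b then lt x y else lt y x)"

definition half :: "'a set \<Rightarrow> 'a \<times> bool \<Rightarrow> ('a \<times> bool) set" where
  "half T p = {z \<in> T. z = fst p \<or> dlt (snd p) (fst p) z} \<times> {snd p}"

definition dspace :: "('a \<times> bool) topology" where
  "dspace = topology (\<lambda>U. U \<subseteq> X \<times> UNIV \<and> (\<forall>p\<in>U. \<exists>T\<in>\<T>. fst p \<in> T \<and> half T p \<subseteq> U))"

lemma refine:
  "T \<in> \<T> \<Longrightarrow> x \<in> T \<Longrightarrow> y \<in> T \<Longrightarrow> dlt b x y \<Longrightarrow> \<exists>T'\<in>\<T>. y \<in> T' \<and> T' \<subseteq> {z \<in> T. dlt b x z}"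
  using refine_left refine_right by (cases b) (simp_all add: dlt_def)

lemma half_mono: "S \<subseteq> T \<Longrightarrow> half S p \<subseteq> half T p"
  by (auto simp: half_def)

lemma openin_dspace:
  "openin dspace U \<longleftrightarrow> U \<subseteq> X \<times> UNIV \<and> (\<forall>p\<in>U. \<exists>T\<in>\<T>. fst p \<in> T \<and> half T p \<subseteq> U)"
proof -
  have "istopology (\<lambda>U. U \<subseteq> X \<times> UNIV \<and> (\<forall>p\<in>U. \<exists>T\<in>\<T>. fst p \<in> T \<and> half T p \<subseteq> U))"
    unfolding istopology_def
  proof (rule conjI; intro allI impI conjI ballI)
    fix U V p
    assume U: "U \<subseteq> X \<times> UNIV \<and> (\<forall>p\<in>U. \<exists>T\<in>\<T>. fst p \<in> T \<and> half T p \<subseteq> U)"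
      and V: "V \<subseteq> X \<times> UNIV \<and> (\<forall>p\<in>V. \<exists>T\<in>\<T>. fst p \<in> T \<and> half T p \<subseteq> V)"
      and p: "p \<in> U \<inter> V"
    obtain S T where ST: "S \<in> \<T>" "fst p \<in> S" "half S p \<subseteq> U" "T \<in> \<T>" "fst p \<in> T" "half T p \<subseteq> V"
      using U V p by (meson IntD1 IntD2)
    then obtain T' where T': "T' \<in> \<T>" "fst p \<in> T'" "T' \<subseteq> S" "T' \<subseteq> T"
      using filtered[of S T "fst p"] by blast
    have "half T' p \<subseteq> U \<inter> V"
      using half_mono[OF T'(3), of p] half_mono[OF T'(4), of p] ST(3,6) by (meson Int_greatest order_trans)
    then show "\<exists>T\<in>\<T>. fst p \<in> T \<and> half T p \<subseteq> U \<inter> V"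
      using T'(1,2) by (intro bexI[of _ T'] conjI)
  next
    fix \<K> p
    assume \<K>: "\<forall>K\<in>\<K>. K \<subseteq> X \<times> UNIV \<and> (\<forall>p\<in>K. \<exists>T\<in>\<T>. fst p \<in> T \<and> half T p \<subseteq> K)"
      and "p \<in> \<Union>\<K>"
    then obtain K where "K \<in> \<K>" "p \<in> K" by blast
    then obtain T where "T \<in> \<T>" "fst p \<in> T" "half T p \<subseteq> K" using \<K> by meson
    then show "\<exists>T\<in>\<T>. fst p \<in> T \<and> half T p \<subseteq> \<Union>\<K>" using \<open>K \<in> \<K>\<close> by blast
  qed blast+
  then show ?thesis by (simp add: dspace_def)
qed

lemma topspace_dspace: "topspace dspace = X \<times> UNIV"
proof
  show "topspace dspace \<subseteq> X \<times> UNIV"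
    using openin_topspace[of dspace] unfolding openin_dspace by blast
  have "openin dspace (X \<times> UNIV)"
    unfolding openin_dspace
  proof (intro conjI ballI)
    fix p :: "'a \<times> bool" assume "p \<in> X \<times> UNIV"
    then obtain T where "T \<in> \<T>" "fst p \<in> T" using covers by auto
    then show "\<exists>T\<in>\<T>. fst p \<in> T \<and> half T p \<subseteq> X \<times> UNIV"
      using subset[of T] by (auto simp: half_def)
  qed simp
  then show "X \<times> UNIV \<subseteq> topspace dspace" by (rule openin_subset)
qed

text \<open>Any other point of the half lies strictly beyond \<open>p\<close>, and there refinement
  fits a whole member of \<T> into the open half. At \<open>p\<close> itself \<open>T\<close> is the
  witness.\<close>

lemma openin_half:
  assumes "T \<in> \<T>" "fst p \<in> T"
  shows "openin dspace (half T p)"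
  unfolding openin_dspace
proof (intro conjI ballI)
  show "half T p \<subseteq> X \<times> UNIV" using subset[OF assms(1)] by (auto simp: half_def)
next
  fix q assume q: "q \<in> half T p"
  show "\<exists>T'\<in>\<T>. fst q \<in> T' \<and> half T' q \<subseteq> half T p"
  proof (cases "q = p")
    case True
    then show ?thesis using assms by blast
  next
    case False
    then have "dlt (snd p) (fst p) (fst q)" "fst q \<in> T" "snd q = snd p"
      using q by (auto simp: half_def)
    then obtain T' where "T' \<in> \<T>" "fst q \<in> T'" "T' \<subseteq> {z \<in> T. dlt (snd p) (fst p) z}"
      using refine[OF assms] by blast
    then show ?thesis using \<open>snd q = snd p\<close> by (auto simp: half_def intro!: bexI[of _ T'])
  qed
qed

text \<open>The halves form a base. They are indexed by a member of \<T>, a point of it and a tag,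
  hence by a subset of a product of three sets of size at most \<kappa>.\<close>

lemma weight_dspace:
  assumes "|X| \<le>o \<kappa>" "|\<T>| \<le>o \<kappa>" "Cinfinite \<kappa>"
  shows "weight dspace \<le>o \<kappa>"
proof -
  let ?\<B> = "(\<lambda>(T, p). half T p) ` (SIGMA T:\<T>. T \<times> UNIV)"
  have "topology_base dspace ?\<B>"
    unfolding topology_base_def
  proof (intro conjI ballI allI impI)
    fix V assume "V \<in> ?\<B>"
    then show "openin dspace V" using openin_half by auto
  next
    fix U p assume "openin dspace U \<and> p \<in> U"
    then obtain T where "T \<in> \<T>" "fst p \<in> T" "half T p \<subseteq> U"
      unfolding openin_dspace by blast
    moreover from this have "p \<in> half T p" by (simp add: half_def mem_Times_iff)
    ultimately show "\<exists>V\<in>?\<B>. p \<in> V \<and> V \<subseteq> U"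
      by (intro bexI[of _ "half T p"] image_eqI[of _ _ "(T, p)"]) (auto simp: mem_Times_iff)
  qed
  moreover have "|?\<B>| \<le>o \<kappa>"
  proof -
    have inf: "\<not> finite (Field \<kappa>)" "Card_order \<kappa>" using assms(3) by (auto simp: cinfinite_def)
    have "|UNIV :: bool set| \<le>o \<kappa>"
      using ctwo_ordLeq_Cinfinite[OF assms(3)] by (simp add: ctwo_def)
    then have "|X \<times> (UNIV :: bool set)| \<le>o \<kappa>"
      using assms(1) inf by (simp add: card_of_Times_ordLeq_infinite_Field)
    then have le: "|\<T> \<times> (X \<times> (UNIV :: bool set))| \<le>o \<kappa>"
      using assms(2) inf by (simp add: card_of_Times_ordLeq_infinite_Field)
    have sub: "(SIGMA T:\<T>. T \<times> (UNIV :: bool set)) \<subseteq> \<T> \<times> (X \<times> UNIV)"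
      using subset by auto
    show ?thesis
      by (rule ordLeq_transitive[OF card_of_image ordLeq_transitive[OF card_of_mono1[OF sub] le]])
  qed
  ultimately show ?thesis unfolding weight_ordLeq_iff by blast
qed

text \<open>In each summand the slices of the cover satisfy the hypotheses of the covering argument,
  for \<open>lt\<close> or its reverse. The two resulting subfamilies of size at most \<mu> together
  still have size below \<kappa>.\<close>

lemma kappa_compact_dspace:
  assumes "|\<T>| \<le>o \<mu>" "Cinfinite \<mu>" "\<mu> <o \<kappa>"
  shows "kappa_compact \<kappa> dspace"
  unfolding kappa_compact_def
proof (intro allI impI)
  fix \<U> assume \<U>: "(\<forall>U\<in>\<U>. openin dspace U) \<and> \<Union>\<U> = topspace dspace"
  have nbhd: "\<exists>U\<in>\<U>. \<exists>T\<in>\<T>. x \<in> T \<and> (\<forall>z\<in>T. z = x \<or> dlt b x z \<longrightarrow> z \<in> {x. (x, b) \<in> U})"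
    if "x \<in> X" for x b
  proof -
    have "(x, b) \<in> \<Union>\<U>" using \<U> that by (simp add: topspace_dspace)
    then obtain U where U: "U \<in> \<U>" "(x, b) \<in> U" by blast
    then have "openin dspace U" using \<U> by blast
    then obtain T where T: "T \<in> \<T>" "x \<in> T" "half T (x, b) \<subseteq> U"
      using U(2) unfolding openin_dspace by (metis fst_conv)
    then have "(z, b) \<in> U" if "z \<in> T" "z = x \<or> dlt b x z" for z
      using that by (auto simp: half_def)
    then show ?thesis using U(1) T(1,2) by blast
  qed
  have dtotal: "dlt b x y \<or> dlt b y x" if "x \<in> X" "y \<in> X" "x \<noteq> y" for x y b
    using total[OF that] by (auto simp: dlt_def)
  have "\<exists>\<V>\<subseteq>\<U>. |\<V>| \<le>o \<mu> \<and> X \<subseteq> (\<Union>V\<in>\<V>. {x. (x, b) \<in> V})" for b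
    using sorgenfrey_subcover[where lt = "dlt b" and \<T> = \<T> and X = X and I = \<U>
        and U = "\<lambda>V. {x. (x, b) \<in> V}", OF dtotal refine assms(1,2) nbhd] by simp
  then obtain \<V> where \<V>: "\<And>b. \<V> b \<subseteq> \<U>" "\<And>b. |\<V> b| \<le>o \<mu>"
      "\<And>b. X \<subseteq> (\<Union>V\<in>\<V> b. {x. (x, b) \<in> V})"
    by metis
  have "|\<V> True \<union> \<V> False| \<le>o \<mu>"
    using \<V>(2) assms(2) by (intro card_of_Un_ordLeq_infinite_Field) (auto simp: cinfinite_def)
  then have "|\<V> True \<union> \<V> False| <o \<kappa>" using assms(3) ordLeq_ordLess_trans by blast
  moreover have "\<Union>(\<V> True \<union> \<V> False) = topspace dspace"
  proof
    show "\<Union>(\<V> True \<union> \<V> False) \<subseteq> topspace dspace" using \<U> \<V>(1) by blast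
    show "topspace dspace \<subseteq> \<Union>(\<V> True \<union> \<V> False)"
    proof
      fix p assume "p \<in> topspace dspace"
      then have "fst p \<in> X" by (auto simp: topspace_dspace)
      then obtain V where "V \<in> \<V> (snd p)" "p \<in> V" using \<V>(3)[of "snd p"] by auto
      then show "p \<in> \<Union>(\<V> True \<union> \<V> False)" by (cases "snd p") auto
    qed
  qed
  ultimately show "\<exists>\<V>\<subseteq>\<U>. |\<V>| <o \<kappa> \<and> \<Union>\<V> = topspace dspace"
    using \<V>(1) by (meson Un_least)
qed

lemma not_kappa_compact_square:
  assumes "\<kappa> \<le>o |X|"
  shows "\<not> kappa_compact \<kappa> (prod_topology dspace dspace)"
proof
  assume comp: "kappa_compact \<kappa> (prod_topology dspace dspace)"
  let ?P = "prod_topology dspace dspace"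
  \<comment> \<open>The opposite tags pair a right half at \<open>x\<close> with a left half at
    \<open>x\<close>. If the box contained \<open>d z\<close> with \<open>z\<close> distinct from
    \<open>x\<close>, then \<open>z\<close> would lie on both sides of \<open>x\<close>, against
    \<open>asym\<close>.\<close>
  define d where "d x = ((x, True), (x, False))" for x :: 'a
  define W where "W = topspace ?P - d ` X"
  have "\<forall>x\<in>X. \<exists>T. T \<in> \<T> \<and> x \<in> T" using covers by blast
  from bchoice[OF this] obtain t where t: "\<And>x. x \<in> X \<Longrightarrow> t x \<in> \<T> \<and> x \<in> t x"
    by blast
  define V where "V x = half (t x) (x, True) \<times> half (t x) (x, False)" for x
  have dV: "d x \<in> V x" if "x \<in> X" for x
    using t[OF that] by (simp add: d_def V_def half_def)
  have dV_eq: "x = y" if "x \<in> X" "y \<in> X" "d x \<in> V y" for x y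
    using that asym[of x y] by (auto simp: d_def V_def half_def dlt_def)
  have openV: "openin ?P (V x)" if "x \<in> X" for x
    using t[OF that] unfolding V_def by (simp add: openin_prod_Times_iff openin_half)
  have openW: "openin ?P W"
    unfolding openin_prod_topology_alt
  proof (intro allI impI)
    fix p q assume pq: "(p, q) \<in> W"
    then have X: "fst p \<in> X" "fst q \<in> X" by (auto simp: W_def topspace_dspace)
    \<comment> \<open>Points of the diagonal have equal first components, so disjoint
      \<open>S\<close> and \<open>T\<close> avoid it. If the components of \<open>p\<close> and
      \<open>q\<close> agree, any choice works: the tags are then not \<open>True\<close>,
      \<open>False\<close> in this order, and halves keep their tags.\<close>
    obtain S T where ST: "S \<in> \<T>" "T \<in> \<T>" "fst p \<in> S" "fst q \<in> T"
      and disj: "fst p \<noteq> fst q \<Longrightarrow> S \<inter> T = {}"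
    proof (cases "fst p = fst q")
      case True
      then show thesis using that[of "t (fst p)" "t (fst q)"] t X by auto
    next
      case False
      then show thesis using that separated[OF X] by blast
    qed
    have miss: "half S p \<times> half T q \<inter> d ` X = {}"
    proof (cases "fst p = fst q")
      case True
      have "(p, q) \<noteq> d (fst p)" using pq imageI[OF X(1), of d] unfolding W_def by force
      with True have "\<not> (snd p \<and> \<not> snd q)" by (cases p; cases q) (simp add: d_def)
      then show ?thesis by (auto simp: half_def d_def)
    next
      case False
      then show ?thesis using disj by (auto simp: half_def d_def)
    qed
    have opn: "openin dspace (half S p)" "openin dspace (half T q)"
      using ST openin_half by auto
    then have "half S p \<times> half T q \<subseteq> topspace ?P"
      by (simp add: openin_subset Sigma_mono)
    with miss have "half S p \<times> half T q \<subseteq> W" unfolding W_def by (simp add: Diff_eq disjoint_eq_subset_Compl)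
    moreover have "p \<in> half S p" "q \<in> half T q"
      using ST by (simp_all add: half_def mem_Times_iff)
    ultimately show "\<exists>A B. openin dspace A \<and> openin dspace B \<and> p \<in> A \<and> q \<in> B \<and> A \<times> B \<subseteq> W"
      using opn by (intro exI[of _ "half S p"] exI[of _ "half T q"] conjI)
  qed
  let ?\<U> = "insert W (V ` X)"
  have opens: "\<forall>U\<in>?\<U>. openin ?P U" using openV openW by simp
  have "\<Union>?\<U> = topspace ?P"
  proof
    show "\<Union>?\<U> \<subseteq> topspace ?P"
      using opens openin_subset[of ?P] by (intro Sup_least) blast
    show "topspace ?P \<subseteq> \<Union>?\<U>" using dV by (auto simp: W_def)
  qed
  with opens obtain \<V> where \<V>: "\<V> \<subseteq> ?\<U>" "|\<V>| <o \<kappa>" "\<Union>\<V> = topspace ?P"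
    using comp unfolding kappa_compact_def by meson
  \<comment> \<open>Only \<open>V x\<close> covers \<open>d x\<close>, so a subcover contains every
    box; since \<open>V\<close> is injective on \<open>X\<close>, it has size at least
    \<kappa>.\<close>
  have "V ` X \<subseteq> \<V>"
  proof (rule image_subsetI)
    fix x assume x: "x \<in> X"
    then have "d x \<in> topspace ?P" by (simp add: d_def topspace_dspace)
    then obtain U where U: "U \<in> \<V>" "d x \<in> U" using \<V>(3) by blast
    then have "U \<noteq> W" using x by (auto simp: W_def)
    then obtain y where "y \<in> X" "U = V y" using U(1) \<V>(1) by blast
    with U dV_eq[OF x] show "V x \<in> \<V>" by blast
  qed
  moreover have "inj_on V X"
    using dV dV_eq by (metis inj_onI)
  ultimately have "|X| \<le>o |\<V>|" using card_of_ordLeq by blast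
  then have "\<kappa> \<le>o |\<V>|" using assms ordLeq_transitive by blast
  then show False using \<V>(2) not_ordLess_ordLeq by blast
qed

lemma not_square_compact:
  assumes "Card_order \<kappa>" "|X| =o \<kappa>" "|\<T>| \<le>o \<mu>" "Cinfinite \<mu>" "\<mu> <o \<kappa>"
  shows "\<not> square_compact \<kappa>"
proof
  assume sq: "square_compact \<kappa>"
  have "\<mu> \<le>o \<kappa>" using assms(5) by (rule ordLess_imp_ordLeq)
  then have "Cinfinite \<kappa>" using assms(1,4) cinfinite_mono by blast
  moreover have "|\<T>| \<le>o \<kappa>" using assms(3) \<open>\<mu> \<le>o \<kappa>\<close> ordLeq_transitive by blast
  ultimately have "weight dspace \<le>o \<kappa>"
    using weight_dspace ordIso_imp_ordLeq[OF assms(2)] by blast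
  \<comment> \<open>The points of \<open>dspace\<close> are not of type \<open>'k set\<close>, so
    the version of square compactness for arbitrary point types is applied.\<close>
  then have "kappa_compact \<kappa> (prod_topology dspace dspace)"
    using sq kappa_compact_dspace[OF assms(3-5)] square_compact_any_type by blast
  moreover have "\<kappa> \<le>o |X|" using assms(2) ordIso_symmetric ordIso_imp_ordLeq by blast
  ultimately show False using not_kappa_compact_square by blast
qed

end

section \<open>The lexicographic order and its cones\<close>

definition lexless :: "'t rel \<Rightarrow> 'm rel \<Rightarrow> ('t \<Rightarrow> 'm) \<Rightarrow> ('t \<Rightarrow> 'm) \<Rightarrow> bool" where
  "lexless \<theta> \<mu> x y \<longleftrightarrow>
     (\<exists>\<delta>\<in>Field \<theta>. (\<forall>\<beta>\<in>underS \<theta> \<delta>. x \<beta> = y \<beta>) \<and> x \<delta> \<noteq> y \<delta> \<and> (x \<delta>, y \<delta>) \<in> \<mu>)"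

text \<open>The coordinate \<alpha> itself is prescribed as well: a cone of \<open>y\<close> at its
  first difference from \<open>x\<close> then lies entirely on one side of \<open>x\<close>.\<close>

definition init_cone :: "'t rel \<Rightarrow> ('t \<Rightarrow> 'm) set \<Rightarrow> ('t \<Rightarrow> 'm) \<Rightarrow> 't \<Rightarrow> ('t \<Rightarrow> 'm) set" where
  "init_cone \<theta> X x \<alpha> = {y \<in> X. \<forall>\<beta>\<in>under \<theta> \<alpha>. y \<beta> = x \<beta>}"

definition cones :: "'t rel \<Rightarrow> ('t \<Rightarrow> 'm) set \<Rightarrow> ('t \<Rightarrow> 'm) set set" where
  "cones \<theta> X = (\<Union>\<alpha>\<in>Field \<theta>. (\<lambda>x. init_cone \<theta> X x \<alpha>) ` X)"

lemma well_order_first_difference: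
  assumes "Well_order \<theta>" "x \<in> Func (Field \<theta>) B" "y \<in> Func (Field \<theta>) B" "x \<noteq> y"
  obtains \<delta> where "\<delta> \<in> Field \<theta>" "x \<delta> \<noteq> y \<delta>" "\<And>\<beta>. \<beta> \<in> underS \<theta> \<delta> \<Longrightarrow> x \<beta> = y \<beta>"
proof -
  \<comment> \<open>Elements of \<open>Func\<close> are all \<open>undefined\<close> outside the
    domain, so distinct ones differ inside it.\<close>
  have "\<exists>\<delta>\<in>Field \<theta>. x \<delta> \<noteq> y \<delta>"
    using assms(2-4) unfolding Func_def by fastforce
  then have "{\<delta> \<in> Field \<theta>. x \<delta> \<noteq> y \<delta>} \<noteq> {}" by blast
  moreover have "wf (\<theta> - Id)" using assms(1) by (simp add: well_order_on_def)
  ultimately obtain \<delta> where "\<delta> \<in> {\<delta> \<in> Field \<theta>. x \<delta> \<noteq> y \<delta>}"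
      "\<And>\<beta>. (\<beta>, \<delta>) \<in> \<theta> - Id \<Longrightarrow> \<beta> \<notin> {\<delta> \<in> Field \<theta>. x \<delta> \<noteq> y \<delta>}"
    by (metis (no_types, lifting) wfE_min ex_in_conv)
  then show thesis
    by (intro that[of \<delta>]) (auto simp: underS_def Field_def)
qed

lemma under_linear:
  assumes "Well_order \<theta>" "\<alpha> \<in> Field \<theta>" "\<beta> \<in> Field \<theta>"
  shows "under \<theta> \<alpha> \<subseteq> under \<theta> \<beta> \<or> \<beta> \<in> underS \<theta> \<alpha>"
proof -
  have tot: "total_on (Field \<theta>) \<theta>" and tr: "trans \<theta>" and refl: "refl_on (Field \<theta>) \<theta>"
    using assms(1) by (auto simp: well_order_on_def linear_order_on_def partial_order_on_def
        preorder_on_def)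
  have "(\<alpha>, \<beta>) \<in> \<theta> \<or> (\<beta>, \<alpha>) \<in> \<theta> \<and> \<beta> \<noteq> \<alpha>"
    using tot refl assms(2,3) by (metis total_on_def refl_onD)
  moreover have "under \<theta> \<alpha> \<subseteq> under \<theta> \<beta>" if "(\<alpha>, \<beta>) \<in> \<theta>"
    using transD[OF tr _ that] by (auto simp: under_def)
  ultimately show ?thesis by (auto simp: underS_def)
qed

text \<open>Every point of a cone generates it, so two cones with a common point are cones of that
  point at two levels and hence nested. Comparison and separation of two functions are both decided
  at their first difference.\<close>

lemma double_sorgenfrey_cones:
  fixes \<mu> :: "'m rel" and \<theta> :: "'t rel"
  assumes \<mu>: "Well_order \<mu>" and \<theta>: "Well_order \<theta>" "Field \<theta> \<noteq> {}"
    and X: "X \<subseteq> Func (Field \<theta>) (Field \<mu>)"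
  shows "double_sorgenfrey X (lexless \<theta> \<mu>) (cones \<theta> X)"
proof -
  have tot: "total_on (Field \<mu>) \<mu>" and anti: "antisym \<mu>"
    using \<mu> by (auto simp: well_order_on_def linear_order_on_def partial_order_on_def)
  have refl: "refl_on (Field \<theta>) \<theta>" and tr: "trans \<theta>"
    using \<theta> by (auto simp: well_order_on_def linear_order_on_def partial_order_on_def
        preorder_on_def)
  have diff: thesis if "x \<in> X" "y \<in> X" "x \<noteq> y"
    "\<And>\<delta>. \<delta> \<in> Field \<theta> \<Longrightarrow> x \<delta> \<noteq> y \<delta> \<Longrightarrow> (\<And>\<beta>. \<beta> \<in> underS \<theta> \<delta> \<Longrightarrow> x \<beta> = y \<beta>) \<Longrightarrow> thesis"
    for x y thesis
    using well_order_first_difference[OF \<theta>(1), of x "Field \<mu>" y] X that by blast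
  have self: "\<delta> \<in> under \<theta> \<delta>" if "\<delta> \<in> Field \<theta>" for \<delta>
    using refl that by (auto simp: under_def refl_on_def)
  have self_cone: "x \<in> init_cone \<theta> X x \<alpha>" if "x \<in> X" for x \<alpha>
    using that by (simp add: init_cone_def)
  have cone_in: "init_cone \<theta> X x \<alpha> \<in> cones \<theta> X" if "x \<in> X" "\<alpha> \<in> Field \<theta>" for x \<alpha>
    using that by (auto simp: cones_def)
  have cone_eq: "init_cone \<theta> X x \<alpha> = init_cone \<theta> X y \<alpha>" if "y \<in> init_cone \<theta> X x \<alpha>" for x y \<alpha>
    using that by (auto simp: init_cone_def)
  have cone_mono: "init_cone \<theta> X x \<alpha> \<subseteq> init_cone \<theta> X x \<beta>" if "under \<theta> \<beta> \<subseteq> under \<theta> \<alpha>" for x \<alpha> \<beta>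
    using that by (auto simp: init_cone_def)
  have underS_under: "underS \<theta> \<delta> \<subseteq> under \<theta> \<delta>" for \<delta>
    by (auto simp: underS_def under_def)
  have unS: "under \<theta> \<beta> \<subseteq> under \<theta> \<alpha>" if "\<beta> \<in> underS \<theta> \<alpha>" for \<alpha> \<beta>
    using transD[OF tr] that by (auto simp: underS_def under_def)
  \<comment> \<open>As \<open>x\<close> and \<open>y\<close> lie in the same cone, a coordinate
    \<delta> where they differ is beyond its level, so the cone of \<open>y\<close> at \<delta>
    stays inside it. The predicate \<open>P\<close> stands for lying to the right or to the left of
    \<open>x\<close>.\<close>
  have refine: "\<exists>T'\<in>cones \<theta> X. y \<in> T' \<and> T' \<subseteq> {z \<in> T. P z}"
    if T: "T \<in> cones \<theta> X" and xT: "x \<in> T" and yT: "y \<in> T" and \<delta>: "\<delta> \<in> Field \<theta>" "x \<delta> \<noteq> y \<delta>"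
      and P: "\<And>z. \<forall>\<beta>\<in>under \<theta> \<delta>. z \<beta> = y \<beta> \<Longrightarrow> P z" for T x y \<delta> P
  proof -
    obtain w \<alpha> where w: "w \<in> X" "\<alpha> \<in> Field \<theta>" "T = init_cone \<theta> X w \<alpha>" using T by (auto simp: cones_def)
    have y: "y \<in> X" "T = init_cone \<theta> X y \<alpha>" using w yT cone_eq by (auto simp: init_cone_def)
    have "\<delta> \<notin> under \<theta> \<alpha>" using xT y(2) \<delta>(2) by (auto simp: init_cone_def)
    then have "under \<theta> \<alpha> \<subseteq> under \<theta> \<delta>"
      using under_linear[OF \<theta>(1) w(2) \<delta>(1)] underS_under by blast
    then have "init_cone \<theta> X y \<delta> \<subseteq> {z \<in> T. P z}"
      using cone_mono[of \<alpha> \<delta> y] y(2) P by (auto simp: init_cone_def)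
    then show ?thesis using cone_in[OF y(1) \<delta>(1)] self_cone[OF y(1)] by blast
  qed
  show ?thesis
  proof
    show "lexless \<theta> \<mu> x y \<or> lexless \<theta> \<mu> y x" if xy: "x \<in> X" "y \<in> X" "x \<noteq> y" for x y
    proof (rule diff[OF xy])
      fix \<delta> assume \<delta>: "\<delta> \<in> Field \<theta>" "x \<delta> \<noteq> y \<delta>" "\<And>\<beta>. \<beta> \<in> underS \<theta> \<delta> \<Longrightarrow> x \<beta> = y \<beta>"
      have "x \<delta> \<in> Field \<mu>" "y \<delta> \<in> Field \<mu>" using X xy \<delta>(1) by (auto simp: Func_def)
      then have "(x \<delta>, y \<delta>) \<in> \<mu> \<or> (y \<delta>, x \<delta>) \<in> \<mu>"
        using tot \<delta>(2) by (auto simp: total_on_def)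
      then show ?thesis using \<delta> unfolding lexless_def by metis
    qed
  next
    fix x y assume xy: "x \<in> X" "y \<in> X" "lexless \<theta> \<mu> x y"
    show "\<not> lexless \<theta> \<mu> y x"
    proof
      assume "lexless \<theta> \<mu> y x"
      then obtain \<epsilon> where \<epsilon>: "\<epsilon> \<in> Field \<theta>" "\<forall>\<beta>\<in>underS \<theta> \<epsilon>. y \<beta> = x \<beta>" "y \<epsilon> \<noteq> x \<epsilon>" "(y \<epsilon>, x \<epsilon>) \<in> \<mu>"
        by (auto simp: lexless_def)
      obtain \<delta> where \<delta>: "\<delta> \<in> Field \<theta>" "\<forall>\<beta>\<in>underS \<theta> \<delta>. x \<beta> = y \<beta>" "x \<delta> \<noteq> y \<delta>" "(x \<delta>, y \<delta>) \<in> \<mu>"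
        using xy(3) by (auto simp: lexless_def)
      \<comment> \<open>Both coordinates are first differences of the same two functions, so they
        coincide, and antisymmetry of \<mu> gives the contradiction.\<close>
      have "\<delta> \<notin> underS \<theta> \<epsilon>" "\<epsilon> \<notin> underS \<theta> \<delta>" using \<delta> \<epsilon> by auto
      then have "under \<theta> \<epsilon> = under \<theta> \<delta>"
        using under_linear[OF \<theta>(1) \<delta>(1) \<epsilon>(1)] under_linear[OF \<theta>(1) \<epsilon>(1) \<delta>(1)] by blast
      then have "\<epsilon> = \<delta>"
        using self[OF \<delta>(1)] \<open>\<delta> \<notin> underS \<theta> \<epsilon>\<close> by (auto simp: under_def underS_def)
      then show False using \<delta> \<epsilon> anti by (auto simp: antisym_def)
    qed
  next
    fix T assume "T \<in> cones \<theta> X" then show "T \<subseteq> X" by (auto simp: cones_def init_cone_def)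
  next
    obtain \<alpha> where "\<alpha> \<in> Field \<theta>" using \<theta>(2) by blast
    then show "X \<subseteq> \<Union>(cones \<theta> X)" using self_cone cone_in by blast
  next
    fix S T x assume S: "S \<in> cones \<theta> X" and T: "T \<in> cones \<theta> X" and x: "x \<in> S" "x \<in> T"
    obtain v \<alpha> where v: "v \<in> X" "\<alpha> \<in> Field \<theta>" "S = init_cone \<theta> X v \<alpha>" using S by (auto simp: cones_def)
    obtain w \<beta> where w: "w \<in> X" "\<beta> \<in> Field \<theta>" "T = init_cone \<theta> X w \<beta>" using T by (auto simp: cones_def)
    have eq: "S = init_cone \<theta> X x \<alpha>" "T = init_cone \<theta> X x \<beta>" using v w x cone_eq by auto
    have "under \<theta> \<alpha> \<subseteq> under \<theta> \<beta> \<or> under \<theta> \<beta> \<subseteq> under \<theta> \<alpha>"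
      using under_linear[OF \<theta>(1) v(2) w(2)] unS by blast
    then have "S \<subseteq> T \<or> T \<subseteq> S" using eq cone_mono by metis
    then show "\<exists>T'\<in>cones \<theta> X. x \<in> T' \<and> T' \<subseteq> S \<inter> T" using S T x by blast
  next
    fix x y assume xy: "x \<in> X" "y \<in> X" "x \<noteq> y"
    show "\<exists>S\<in>cones \<theta> X. \<exists>T\<in>cones \<theta> X. x \<in> S \<and> y \<in> T \<and> S \<inter> T = {}"
    proof (rule diff[OF xy])
      fix \<delta> assume \<delta>: "\<delta> \<in> Field \<theta>" "x \<delta> \<noteq> y \<delta>"
      then have "init_cone \<theta> X x \<delta> \<inter> init_cone \<theta> X y \<delta> = {}"
        using self[OF \<delta>(1)] by (auto simp: init_cone_def)
      then show ?thesis using xy \<delta>(1) self_cone cone_in by meson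
    qed
  next
    fix T x y assume T: "T \<in> cones \<theta> X" "x \<in> T" "y \<in> T" and "lexless \<theta> \<mu> x y"
    then obtain \<delta> where \<delta>: "\<delta> \<in> Field \<theta>" "\<forall>\<beta>\<in>underS \<theta> \<delta>. x \<beta> = y \<beta>" "x \<delta> \<noteq> y \<delta>" "(x \<delta>, y \<delta>) \<in> \<mu>"
      by (auto simp: lexless_def)
    show "\<exists>T'\<in>cones \<theta> X. y \<in> T' \<and> T' \<subseteq> {z \<in> T. lexless \<theta> \<mu> x z}"
    proof (rule refine[OF T \<delta>(1,3)])
      fix z assume "\<forall>\<beta>\<in>under \<theta> \<delta>. z \<beta> = y \<beta>"
      then show "lexless \<theta> \<mu> x z"
        unfolding lexless_def using \<delta> self[OF \<delta>(1)] underS_under[of \<delta>]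
        by (intro bexI[of _ \<delta>]) auto
    qed
  next
    fix T x y assume T: "T \<in> cones \<theta> X" "x \<in> T" "y \<in> T" and "lexless \<theta> \<mu> y x"
    then obtain \<delta> where \<delta>: "\<delta> \<in> Field \<theta>" "\<forall>\<beta>\<in>underS \<theta> \<delta>. y \<beta> = x \<beta>" "x \<delta> \<noteq> y \<delta>" "(y \<delta>, x \<delta>) \<in> \<mu>"
      by (auto simp: lexless_def)
    show "\<exists>T'\<in>cones \<theta> X. y \<in> T' \<and> T' \<subseteq> {z \<in> T. lexless \<theta> \<mu> z x}"
    proof (rule refine[OF T \<delta>(1,3)])
      fix z assume "\<forall>\<beta>\<in>under \<theta> \<delta>. z \<beta> = y \<beta>"
      then show "lexless \<theta> \<mu> z x"
        unfolding lexless_def using \<delta> self[OF \<delta>(1)] underS_under[of \<delta>]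
        by (intro bexI[of _ \<delta>]) auto
    qed
  qed
qed

section \<open>Cardinal arithmetic: counting cones and excluding degenerate cases\<close>

text \<open>Since \<open>A\<close> is a set over the type of \<theta>, \<open>|A|\<close> is one of
  the exponents over which \<open>cexp_less\<close> takes its supremum.\<close>

lemma card_of_Func_cexp_less:
  fixes \<mu> :: "'m rel" and \<theta> :: "'t rel"
  assumes "cexp_less \<mu> \<theta> =o \<mu>" "A \<subseteq> Field \<theta>" "|A| <o \<theta>"
  shows "|Func A (Field \<mu>)| \<le>o \<mu>"
proof -
  have "\<mu> ^c |A| \<le>o cexp_less \<mu> \<theta>"
    using cexp_less_is_least_bound(1)[of \<mu> \<theta>] assms(3)
    unfolding cexp_less_bound_def by (simp add: card_of_Card_order)
  then have "\<mu> ^c |A| \<le>o \<mu>" using assms(1) ordLeq_ordIso_trans by blast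
  then show ?thesis by (simp add: cexp_def Field_card_of)
qed

text \<open>An infinite cardinal has no last element, so the closed segment lies in a strict segment
  of a later element, and strict segments of a cardinal are smaller than it.\<close>

lemma card_of_under:
  assumes "Cinfinite r" "a \<in> Field r"
  shows "|under r a| <o r"
proof -
  obtain b where b: "b \<in> Field r" "a \<noteq> b" "(a, b) \<in> r"
    using infinite_Card_order_limit assms by (metis cinfinite_def)
  have tr: "trans r" and anti: "antisym r"
    using assms(1) by (auto simp: card_order_on_def well_order_on_def linear_order_on_def
        partial_order_on_def preorder_on_def)
  have "under r a \<subseteq> underS r b"
    using b transD[OF tr _ b(3)] antisymD[OF anti b(3)] by (auto simp: under_def underS_def)
  then have "|under r a| \<le>o |underS r b|" by (rule card_of_mono1)
  moreover have "|underS r b| <o r" using assms(1) b(1) by (intro card_of_underS) auto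
  ultimately show ?thesis by (rule ordLeq_ordLess_trans)
qed

text \<open>A cone at level \<alpha> depends only on a function on
  \<open>under \<theta> \<alpha>\<close>, a set smaller than \<theta>, so each level has at most
  \<mu> cones; and there are \<theta> \<le> \<mu> levels.\<close>

lemma card_of_cones:
  fixes \<mu> :: "'m rel" and \<theta> :: "'t rel"
  assumes "Cinfinite \<mu>" "Cinfinite \<theta>" "\<theta> \<le>o \<mu>" "cexp_less \<mu> \<theta> =o \<mu>"
    and X: "X \<subseteq> Func (Field \<theta>) (Field \<mu>)"
  shows "|cones \<theta> X| \<le>o \<mu>"
proof -
  have "|(\<lambda>x. init_cone \<theta> X x \<alpha>) ` X| \<le>o \<mu>" if \<alpha>: "\<alpha> \<in> Field \<theta>" for \<alpha>
  proof -
    let ?r = "\<lambda>x \<beta>. if \<beta> \<in> under \<theta> \<alpha> then x \<beta> else undefined"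
    have sub: "under \<theta> \<alpha> \<subseteq> Field \<theta>" by (rule under_Field)
    have "|under \<theta> \<alpha>| <o \<theta>"
      using assms(2) \<alpha> by (rule card_of_under)
    with assms(4) sub have le: "|Func (under \<theta> \<alpha>) (Field \<mu>)| \<le>o \<mu>"
      by (rule card_of_Func_cexp_less)
    have "?r ` X \<subseteq> Func (under \<theta> \<alpha>) (Field \<mu>)"
      using X sub by (force simp: Func_def)
    then have "|?r ` X| \<le>o \<mu>" by (rule ordLeq_transitive[OF card_of_mono1 le])
    \<comment> \<open>Truncating \<open>x\<close> beyond \<alpha> does not change its cone at
      \<alpha>, so the cones are counted through the truncations.\<close>
    moreover have "(\<lambda>x. init_cone \<theta> X x \<alpha>) ` X = (\<lambda>x. init_cone \<theta> X x \<alpha>) ` ?r ` X"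
      by (auto simp: image_image init_cone_def)
    ultimately show ?thesis by (simp only: ordLeq_transitive[OF card_of_image])
  qed
  moreover have "|Field \<theta>| \<le>o \<mu>"
    using assms(2,3) card_of_Field_ordIso ordIso_ordLeq_trans by blast
  ultimately have "|\<Union>\<alpha>\<in>Field \<theta>. (\<lambda>x. init_cone \<theta> X x \<alpha>) ` X| \<le>o \<mu>"
    using assms(1) by (intro card_of_UNION_ordLeq_infinite_Field) (auto simp: cinfinite_def)
  then show ?thesis by (simp add: cones_def)
qed

lemma card_of_Func_finite_infinite:
  assumes "finite A" "infinite B"
  shows "|Func A B| \<le>o |B|"
  using assms(1)
proof (induction A)
  case empty
  have "|Func {} B| \<le>o |{b}|" for b :: 'b
    by (rule surj_imp_ordLeq[of _ "\<lambda>_ _. undefined"]) (auto simp: Func_def)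
  moreover obtain b where "b \<in> B" using assms(2) by fastforce
  then have "|{b}| \<le>o |B|" by (intro card_of_mono1) simp
  ultimately show ?case using ordLeq_transitive by blast
next
  case (insert a A)
  \<comment> \<open>A function is split into its value at \<open>a\<close> and the rest; the reset
    to \<open>undefined\<close> puts the rest into \<open>Func A B\<close>.\<close>
  have "inj_on (\<lambda>f. (f a, f(a := undefined))) (Func (insert a A) B)"
    by (rule inj_onI) (metis fst_conv snd_conv fun_upd_triv fun_upd_upd)
  moreover have "(\<lambda>f. (f a, f(a := undefined))) ` Func (insert a A) B \<subseteq> B \<times> Func A B"
    using insert(2) by (auto simp: Func_def)
  ultimately have "|Func (insert a A) B| \<le>o |B \<times> Func A B|" using card_of_ordLeq by blast
  moreover have "|B \<times> Func A B| \<le>o |B|"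
    using card_of_Times_ordLeq_infinite_Field[of "|B|", OF _ ordIso_imp_ordLeq[OF card_of_refl]
        insert.IH card_of_Card_order] assms(2) by (simp add: Field_card_of)
  ultimately show ?case using ordLeq_transitive by blast
qed

text \<open>If \<mu> were below \<theta>, then \<mu> itself would be an admissible exponent, and a
  base with two elements would embed a power set of size 2 to the \<mu> into \<mu>, against
  Cantor.\<close>

lemma cexp_less_eq_imp_ordLeq:
  fixes \<mu> :: "'m rel" and \<theta> :: "'t rel"
  assumes "Card_order \<mu>" "Card_order \<theta>" "cexp_less \<mu> \<theta> =o \<mu>"
    and "a \<in> Field \<mu>" "b \<in> Field \<mu>" "a \<noteq> b"
  shows "\<theta> \<le>o \<mu>"
proof (rule ccontr)
  assume "\<not> \<theta> \<le>o \<mu>"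
  then have less: "\<mu> <o \<theta>"
    using assms(1,2) not_ordLeq_iff_ordLess card_order_on_well_order_on by metis
  have F: "|Field \<mu>| =o \<mu>" using assms(1) card_of_Field_ordIso by blast
  then have "|Field \<mu>| \<le>o \<theta>" using less ordIso_ordLess_trans ordLess_imp_ordLeq by blast
  \<comment> \<open>A copy of \<mu> inside the field of \<theta>, since the exponents of
    \<open>cexp_less\<close> live on that type.\<close>
  then obtain A where A: "A \<subseteq> Field \<theta>" "|Field \<mu>| =o |A|"
    using internalize_card_of_ordLeq[of "Field \<mu>" \<theta>] by blast
  have \<mu>A: "\<mu> =o |A|" using F A(2) ordIso_symmetric ordIso_transitive by blast
  then have "|A| <o \<theta>" using less ordIso_symmetric ordIso_ordLess_trans by blast
  then have "|Func A (Field \<mu>)| \<le>o \<mu>" using card_of_Func_cexp_less[OF assms(3) A(1)] by blast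
  then have Func_le: "|Func A (Field \<mu>)| \<le>o |A|" using \<mu>A ordLeq_ordIso_trans by blast
  let ?\<chi> = "\<lambda>S x. if x \<in> A then if x \<in> S then a else b else undefined"
  have "inj_on ?\<chi> (Pow A)"
  proof (rule inj_onI)
    fix S T assume ST: "S \<in> Pow A" "T \<in> Pow A" "?\<chi> S = ?\<chi> T"
    have "x \<in> S \<longleftrightarrow> x \<in> T" if "x \<in> A" for x
      using fun_cong[OF ST(3), of x] that assms(6) by (auto split: if_splits)
    then show "S = T" using ST(1,2) by blast
  qed
  moreover have "?\<chi> ` Pow A \<subseteq> Func A (Field \<mu>)"
    using assms(4,5) by (auto simp: Func_def)
  ultimately have "|Pow A| \<le>o |Func A (Field \<mu>)|" using card_of_ordLeq by blast
  then have "|Pow A| \<le>o |A|" using Func_le ordLeq_transitive by blast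
  then show False using card_of_Pow[of A] not_ordLess_ordLeq by blast
qed

text \<open>Each degenerate case makes \<open>\<mu> ^c \<theta>\<close> too small for \<kappa>: at
  most one value leaves at most one function; a finite \<mu> bounds \<theta> and makes the power
  finite; a finite \<theta> over an infinite \<mu> gives a power of size at most \<mu>.\<close>

lemma Cinfinite_of_cexp_less_eq:
  fixes \<kappa> :: "'k rel" and \<mu> :: "'m rel" and \<theta> :: "'t rel"
  assumes "Cinfinite \<kappa>" "Card_order \<mu>" "Card_order \<theta>"
    and "cexp_less \<mu> \<theta> =o \<mu>" "\<mu> <o \<kappa>" "\<kappa> \<le>o \<mu> ^c \<theta>"
  shows "Cinfinite \<mu>" "Cinfinite \<theta>" "\<theta> \<le>o \<mu>"
proof -
  have \<kappa>: "\<kappa> \<le>o |Func (Field \<theta>) (Field \<mu>)|" using assms(6) by (simp add: cexp_def)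
  then have "cinfinite |Func (Field \<theta>) (Field \<mu>)|" using assms(1) cinfinite_mono by blast
  then have inf: "infinite (Func (Field \<theta>) (Field \<mu>))" by (simp add: cinfinite_def Field_card_of)
  have "\<exists>a\<in>Field \<mu>. \<exists>b\<in>Field \<mu>. a \<noteq> b"
  proof (rule ccontr)
    assume "\<not> ?thesis"
    then have "f = g" if "f \<in> Func (Field \<theta>) (Field \<mu>)" "g \<in> Func (Field \<theta>) (Field \<mu>)" for f g
      using that unfolding Func_def by fastforce
    then have "Func (Field \<theta>) (Field \<mu>) \<subseteq> {SOME f. f \<in> Func (Field \<theta>) (Field \<mu>)}"
      by (metis (mono_tags, lifting) someI singletonI subsetI)
    then show False using inf finite_subset by blast
  qed
  then show le: "\<theta> \<le>o \<mu>" using cexp_less_eq_imp_ordLeq[OF assms(2-4)] by blast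
  have "infinite (Field \<mu>)"
  proof
    assume fin: "finite (Field \<mu>)"
    have "|Field \<theta>| \<le>o |Field \<mu>|" using le card_of_mono2 by blast
    then have "finite (Field \<theta>)" using fin card_of_ordLeq_finite by blast
    then have "finite (Func (Field \<theta>) (Field \<mu>))" 
      using finite_set_of_finite_funs[OF _ fin, of "Field \<theta>" undefined]
      by (rule_tac rev_finite_subset) (auto simp: Func_def)
    then show False using inf by blast
  qed
  then show "Cinfinite \<mu>" using assms(2) by (simp add: cinfinite_def)
  have "infinite (Field \<theta>)"
  proof
    assume "finite (Field \<theta>)"
    then have "|Func (Field \<theta>) (Field \<mu>)| \<le>o |Field \<mu>|"
      using \<open>infinite (Field \<mu>)\<close> by (rule card_of_Func_finite_infinite)
    then have "\<kappa> \<le>o |Field \<mu>|" using \<kappa> ordLeq_transitive by blast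
    then have "\<kappa> \<le>o \<mu>" using card_of_Field_ordIso[OF assms(2)] ordLeq_ordIso_trans by blast
    then show False using assms(5) not_ordLess_ordLeq by blast
  qed
  then show "Cinfinite \<theta>" using assms(3) by (simp add: cinfinite_def)
qed

section \<open>Assembling the counterexample\<close>

theorem theorem2p8:
  fixes \<kappa> :: "'k rel" and \<mu> :: "'m rel" and \<theta> :: "'t rel"
  assumes "Card_order \<kappa>" and "cardSuc natLeq \<le>o \<kappa>"
    and "Card_order \<mu>" and "Card_order \<theta>"
    and "cexp_less \<mu> \<theta> =o \<mu>" and "\<mu> <o \<kappa>" and "\<kappa> \<le>o \<mu> ^c \<theta>"
  shows "\<not> square_compact \<kappa>"
proof -
  have "Cinfinite (cardSuc natLeq)"
    by (intro Cinfinite_cardSuc natLeq_Cinfinite)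
  then have \<kappa>: "Cinfinite \<kappa>" using assms(1,2) cinfinite_mono by blast
  note inf = Cinfinite_of_cexp_less_eq[OF \<kappa> assms(3-7)]
  have F\<kappa>: "|Field \<kappa>| =o \<kappa>" using assms(1) card_of_Field_ordIso by blast
  then have "|Field \<kappa>| \<le>o |Func (Field \<theta>) (Field \<mu>)|"
    using assms(7) ordIso_ordLeq_trans unfolding cexp_def by blast
  \<comment> \<open>The point set is cut down to size exactly \<kappa>: large enough for the
    diagonal to defeat compactness of the square, small enough for weight at most \<kappa>.\<close>
  then obtain X where X: "X \<subseteq> Func (Field \<theta>) (Field \<mu>)" "|Field \<kappa>| =o |X|"
    using iffD1[OF internalize_card_of_ordLeq2] by metis
  have "|X| =o \<kappa>" using X(2) F\<kappa> ordIso_symmetric ordIso_transitive by blast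
  have "Field \<theta> \<noteq> {}" using inf(2) by (auto simp: cinfinite_def)
  then interpret double_sorgenfrey X "lexless \<theta> \<mu>" "cones \<theta> X"
    using assms(3,4) X(1) by (intro double_sorgenfrey_cones) (auto simp: card_order_on_well_order_on)
  show ?thesis
    using not_square_compact[OF assms(1) \<open>|X| =o \<kappa>\<close> card_of_cones[OF inf assms(5) X(1)] inf(1) assms(6)] .
qed

end
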